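(* Let $p=1$ and $0<\kappa<1$. Let $V\ge0$ be locally integrable on $\mathbb H^n$, $V\not\equiv0$, with $V\in RH_s$ for some $s\geq Q/2$. Then for each fixed $N\in\mathbb N$, the maximal operator $\mathcal M_{\rho,N}$ is bounded from $L^{1,\kappa}_{\rho,\theta}(\mathbb H^n)$ into $WL^{1,\kappa}_{\rho,\theta}(\mathbb H^n)$ for every $\theta$ with $0<\theta(N_0+1)\le N$.
   Context: The Heisenberg group $\mathbb H^n$ is $\mathbb C^n\times\mathbb R$ with multiplication $(z,t)\cdot(z',t')=(z+z',t+t'+2\,\mathrm{Im}(z\cdot\overline{z'}))$, $z\cdot\overline{z'}=\sum_j z_j\overline{z_j'}$; inverse $(z,t)^{-1}=(-z,-t)$; Haar measure is Lebesgue measure, $|E|$ the measure. Homogeneous norm $|(z,t)|=(|z|^4+t^2)^{1/4}$, balls $B(u,r)=\{v:|u^{-1}v|<r\}$, $Q=2n+2$. $V\in RH_s$ means $\big(\frac1{|B|}\int_B V^s\big)^{1/s}\le C\frac1{|B|}\int_B V$ for all balls. Critical radius: $\rho(u)=\sup\{r>0: r^{2-Q}\int_{B(u,r)}V\le 1\}\in(0,\infty)$. $N_0>0$ (together with $C_0\ge1$) denotes constants, which exist under these hypotheses, such that for all $u,v$: $C_0^{-1}[1+|v^{-1}u|/\rho(u)]^{-N_0}\le\rho(v)/\rho(u)\le C_0[1+|v^{-1}u|/\rho(u)]^{N_0/(N_0+1)}$. $\mathcal M_{\rho,N}f(u)=\sup_{r>0}[1+r/\rho(u)]^{-N}\frac1{|B(u,r)|}\int_{B(u,r)}|f|$.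 For $\theta>0$: $\|f\|_{L^{1,\kappa}_{\rho,\theta}}:=\sup_{B=B(u_0,r)}[1+r/\rho(u_0)]^{-\theta}|B|^{-\kappa}\int_B|f|$ and $\|f\|_{WL^{1,\kappa}_{\rho,\theta}}:=\sup_{B=B(u_0,r)}[1+r/\rho(u_0)]^{-\theta}|B|^{-\kappa}\sup_{\lambda>0}\lambda|\{u\in B:|f(u)|>\lambda\}|$; the spaces are the sets where these are finite. *)

theory Defs
  imports "HOL-Analysis.Analysis"
begin

type_synonym 'n heis = "(complex ^ 'n) \<times> real"

definition hdot :: "complex ^ 'n \<Rightarrow> complex ^ 'n \<Rightarrow> complex" where
  "hdot z w = (\<Sum>j\<in>UNIV. z $ j * cnj (w $ j))"

definition hmult :: "('n::finite) heis \<Rightarrow> 'n heis \<Rightarrow> 'n heis" where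
  "hmult u v = (fst u + fst v, snd u + snd v + 2 * Im (hdot (fst u) (fst v)))"

definition hinv :: "('n::finite) heis \<Rightarrow> 'n heis" where
  "hinv u = (- fst u, - snd u)"

definition hnorm :: "('n::finite) heis \<Rightarrow> real" where
  "hnorm u = ((norm (fst u)) ^ 4 + (snd u)\<^sup>2) powr (1/4)"

definition hball :: "('n::finite) heis \<Rightarrow> real \<Rightarrow> 'n heis set" where
  "hball u r = {v. hnorm (hmult (hinv u) v) < r}"

definition Qdim :: "('n::finite) itself \<Rightarrow> real" where
  "Qdim _ = 2 * real CARD('n) + 2"

definition RH :: "real \<Rightarrow> (('n::finite) heis \<Rightarrow> real) \<Rightarrow> bool" where
  "RH s V \<longleftrightarrow> (\<exists>C. \<forall>u r. r > 0 \<longrightarrow>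
     set_integrable lebesgue (hball u r) (\<lambda>v. V v powr s) \<and>
     ((LINT v:hball u r|lebesgue. V v powr s) / measure lebesgue (hball u r)) powr (1/s)
       \<le> C * ((LINT v:hball u r|lebesgue. V v) / measure lebesgue (hball u r)))"

definition crit_radius :: "(('n::finite) heis \<Rightarrow> real) \<Rightarrow> 'n heis \<Rightarrow> real" where
  "crit_radius V u = Sup {r. r > 0 \<and>
      r powr (2 - Qdim TYPE('n)) * (LINT v:hball u r|lebesgue. V v) \<le> 1}"

definition maxop :: "(('n::finite) heis \<Rightarrow> real) \<Rightarrow> real \<Rightarrow> ('n heis \<Rightarrow> real) \<Rightarrow> 'n heis \<Rightarrow> ennreal" where
  "maxop \<rho> N f u = (SUP r\<in>{0<..}. ennreal ((1 + r / \<rho> u) powr (- N)) *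
      (set_nn_integral lebesgue (hball u r) (\<lambda>v. ennreal \<bar>f v\<bar>) / emeasure lebesgue (hball u r)))"

definition morrey_norm :: "(('n::finite) heis \<Rightarrow> real) \<Rightarrow> real \<Rightarrow> real \<Rightarrow> ('n heis \<Rightarrow> real) \<Rightarrow> ennreal" where
  "morrey_norm \<rho> \<theta> \<kappa> f = (SUP ur\<in>UNIV \<times> {0<..}.
      ennreal ((1 + snd ur / \<rho> (fst ur)) powr (- \<theta>) * (measure lebesgue (hball (fst ur) (snd ur))) powr (- \<kappa>))
      * set_nn_integral lebesgue (hball (fst ur) (snd ur)) (\<lambda>v. ennreal \<bar>f v\<bar>))"

definition weak_morrey_norm :: "(('n::finite) heis \<Rightarrow> real) \<Rightarrow> real \<Rightarrow> real \<Rightarrow> ('n heis \<Rightarrow> ennreal) \<Rightarrow> ennreal" where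
  "weak_morrey_norm \<rho> \<theta> \<kappa> g = (SUP ur\<in>UNIV \<times> {0<..}.
      ennreal ((1 + snd ur / \<rho> (fst ur)) powr (- \<theta>) * (measure lebesgue (hball (fst ur) (snd ur))) powr (- \<kappa>))
      * (SUP lam\<in>{0<..}. ennreal lam * emeasure lebesgue {v \<in> hball (fst ur) (snd ur). g v > ennreal lam}))"

end

theory Submission
  imports Defs
begin

text \<open>
  Fix a ball \<open>B = B(u\<^sub>0, r)\<close> and split the radii \<open>R\<close> in the maximal operator at \<open>u \<in> B\<close>.
  For \<open>R > r\<close> the Morrey norm, tested on \<open>B(u, R)\<close> itself, bounds the weighted average by
  \<open>\<parallel>f\<parallel> (1 + R / \<rho> u)\<^bsup>\<theta> - N\<^esup> |B(u, R)|\<^bsup>\<kappa> - 1\<^esup> \<le> \<parallel>f\<parallel> |B|\<^bsup>\<kappa> - 1\<^esup>\<close>, because \<open>\<theta> \<le> N\<close> and \<open>\<kappa> < 1\<close>.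
  For \<open>R \<le> r\<close> the weight is at most 1 and \<open>B(u, R) \<subseteq> B(u\<^sub>0, 2r)\<close>, so the Vitali covering argument
  gives the weak type bound by the integral of \<open>|f|\<close> over \<open>B(u\<^sub>0, 2r)\<close>, which is tested by the norm.
  The comparison between values of the critical radius serves only to make it positive.
\<close>

section \<open>Geometry of the Heisenberg group\<close>

lemma hdot_minus_left: "hdot (- x) z = - hdot x z"
  by (simp add: hdot_def sum_negf)

lemma hdot_diff_left: "hdot (x - y) z = hdot x z - hdot y z"
  by (simp add: hdot_def left_diff_distrib sum_subtractf)

lemma hdot_diff_right: "hdot x (y - z) = hdot x y - hdot x z"
  by (simp add: hdot_def right_diff_distrib sum_subtractf)

lemma hdot_commute: "hdot x y = cnj (hdot y x)"
  by (simp add: hdot_def mult.commute)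

lemma Im_hdot_commute: "Im (hdot x y) = - Im (hdot y x)"
  by (subst hdot_commute) simp

lemma Im_hdot_self [simp]: "Im (hdot x x) = 0"
  using Im_hdot_commute[of x x] by simp

lemma Re_hdot: "Re (hdot x y) = x \<bullet> y"
  by (simp add: hdot_def inner_vec_def inner_complex_def)

lemma norm_hdot_le: "cmod (hdot x y) \<le> norm x * norm y"
proof -
  have "cmod (hdot x y) \<le> (\<Sum>j\<in>UNIV. \<bar>cmod (x $ j)\<bar> * \<bar>cmod (y $ j)\<bar>)"
    unfolding hdot_def by (rule order_trans[OF norm_sum]) (simp add: norm_mult)
  also have "\<dots> \<le> norm x * norm y"
    unfolding norm_vec_def by (rule L2_set_mult_ineq)
  finally show ?thesis .
qed

lemma continuous_on_hdot [continuous_intros]: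
  "continuous_on S f \<Longrightarrow> continuous_on S g \<Longrightarrow> continuous_on S (\<lambda>x. hdot (f x) (g x))"
  unfolding hdot_def by (intro continuous_intros)

section \<open>The homogeneous norm and its triangle inequality\<close>

lemma hnorm_nonneg [simp]: "0 \<le> hnorm u"
  by (simp add: hnorm_def)

lemma hnorm_less_iff:
  assumes "r > 0"
  shows "hnorm u < r \<longleftrightarrow> norm (fst u) ^ 4 + (snd u)\<^sup>2 < r ^ 4"
proof -
  have "hnorm u < (r ^ 4) powr (1/4) \<longleftrightarrow> norm (fst u) ^ 4 + (snd u)\<^sup>2 < r ^ 4"
    unfolding hnorm_def using assms
    by (smt (verit) powr_less_mono2 powr_mono2 zero_le_power zero_le_power2 norm_ge_zero
      zero_less_divide_1_iff)
  moreover have "(r ^ 4) powr (1/4) = r"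
    using assms by (simp add: powr_powr flip: powr_numeral)
  ultimately show ?thesis by simp
qed

lemma hnorm_power2: "(hnorm u)\<^sup>2 = cmod (Complex ((norm (fst u))\<^sup>2) (snd u))"
proof -
  let ?a = "norm (fst u) ^ 4 + (snd u)\<^sup>2"
  have "(hnorm u)\<^sup>2 = ?a powr (1/2)"
    unfolding hnorm_def by (simp add: powr_powr power2_eq_square flip: powr_add)
  also have "\<dots> = sqrt ?a"
    by (rule powr_half_sqrt) auto
  finally show ?thesis
    by (simp add: cmod_def)
qed

lemma hnorm_hinv [simp]: "hnorm (hinv u) = hnorm u"
  by (simp add: hnorm_def hinv_def)

text \<open>
  With \<open>w = |z|\<^sup>2 + i t\<close> one has \<open>|(z, t)|\<^sup>2 = |w|\<close>, and multiplication in the group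
  adds the corresponding numbers \<open>w\<close> up to the term \<open>2 z \<cdot> cnj z'\<close>.
\<close>
lemma hnorm_hmult_le: "hnorm (hmult u v) \<le> hnorm u + hnorm v"
proof -
  let ?w = "\<lambda>u. Complex ((norm (fst u))\<^sup>2) (snd u)"
  have fst_le: "norm (fst u) \<le> hnorm u" for u :: "'a heis"
  proof (rule power2_le_imp_le)
    show "(norm (fst u))\<^sup>2 \<le> (hnorm u)\<^sup>2"
      unfolding hnorm_power2 using abs_Re_le_cmod[of "?w u"] by simp
  qed simp
  \<comment> \<open>The real part is the expansion of the squared norm of a sum; the imaginary part
    is the twist in the group law. The factor 2 there is what makes both fit one complex
    number.\<close>
  have "?w (hmult u v) = ?w u + ?w v + 2 * hdot (fst u) (fst v)"
    by (simp add: complex_eq_iff hmult_def Re_hdot power2_norm_eq_inner inner_add_left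
        inner_add_right inner_commute)
  then have "(hnorm (hmult u v))\<^sup>2 = cmod (?w u + ?w v + 2 * hdot (fst u) (fst v))"
    by (simp only: hnorm_power2)
  also have "\<dots> \<le> cmod (?w u) + cmod (?w v) + 2 * cmod (hdot (fst u) (fst v))"
    by (intro order_trans[OF norm_triangle_ineq] add_mono order_refl) (simp add: norm_mult)
  also have "\<dots> \<le> (hnorm u)\<^sup>2 + (hnorm v)\<^sup>2 + 2 * (hnorm u * hnorm v)"
    unfolding hnorm_power2[symmetric]
    by (intro add_mono mult_left_mono order_refl order_trans[OF norm_hdot_le] mult_mono fst_le) auto
  also have "\<dots> = (hnorm u + hnorm v)\<^sup>2"
    by (simp add: power2_sum)
  finally show ?thesis
    by (rule power2_le_imp_le) simp
qed

section \<open>The left-invariant metric and its balls\<close>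

definition hdist :: "('n::finite) heis \<Rightarrow> 'n heis \<Rightarrow> real" where
  "hdist u v = hnorm (hmult (hinv u) v)"

lemma hball_eq_hdist: "hball u r = {v. hdist u v < r}"
  by (simp add: hball_def hdist_def)

lemma hdist_nonneg [simp]: "0 \<le> hdist u v"
  by (simp add: hdist_def)

lemma hdist_self [simp]: "hdist u u = 0"
  by (simp add: hdist_def hmult_def hinv_def hnorm_def hdot_minus_left)

lemma hdist_commute: "hdist u v = hdist v u"
proof -
  have "hmult (hinv v) u = hinv (hmult (hinv u) v)"
    by (simp add: hmult_def hinv_def hdot_minus_left Im_hdot_commute[of "fst v"])
  then show ?thesis by (simp add: hdist_def)
qed

text \<open>The inner factors cancel in \<open>(u\<inverse>v)(v\<inverse>w) = u\<inverse>w\<close>,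
  so subadditivity of \<open>hnorm\<close> applies.\<close>

lemma hdist_triangle: "hdist u w \<le> hdist u v + hdist v w"
proof -
  have "hmult (hinv u) w = hmult (hmult (hinv u) v) (hmult (hinv v) w)"
    by (simp add: hmult_def hinv_def hdot_minus_left hdot_diff_left hdot_diff_right
        Im_hdot_commute[of "fst v" "fst u"] Im_hdot_commute[of "fst w" "fst v"])
  then show ?thesis
    using hnorm_hmult_le[of "hmult (hinv u) v" "hmult (hinv v) w"] by (simp add: hdist_def)
qed

lemma continuous_on_hdist [continuous_intros]:
  fixes f g :: "'a::topological_space \<Rightarrow> 'b::finite heis"
  assumes "continuous_on S f" "continuous_on S g"
  shows "continuous_on S (\<lambda>x. hdist (f x) (g x))"
proof -
  \<comment> \<open>Nested square roots are continuous everywhere, including where the base of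
    \<open>powr\<close> vanishes.\<close>
  have "hnorm u = sqrt (sqrt (norm (fst u) ^ 4 + (snd u)\<^sup>2))" for u :: "'b heis"
    by (metis hnorm_power2 hnorm_nonneg real_sqrt_unique cmod_def complex.sel power_mult
        mult_2 numeral_Bit0)
  then show ?thesis
    unfolding hdist_def hmult_def hinv_def using assms by (auto intro!: continuous_intros)
qed

lemma open_hball [simp]: "open (hball u r)"
  unfolding hball_eq_hdist by (intro open_Collect_less continuous_intros)

lemma hball_in_lebesgue [measurable, simp]: "hball u r \<in> sets lebesgue"
  using open_hball by auto

lemma hball_subset:
  "hdist u v + r \<le> s \<Longrightarrow> hball v r \<subseteq> hball u s"
  unfolding hball_eq_hdist by (auto intro: le_less_trans[OF hdist_triangle[of u _ v]])

lemma centre_in_hball [simp]: "u \<in> hball u r \<longleftrightarrow> r > 0"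
  by (simp add: hball_eq_hdist)

lemma hball_empty: "r \<le> 0 \<Longrightarrow> hball u r = {}"
  using hdist_nonneg by (auto simp: hball_eq_hdist not_less intro: order_trans)

section \<open>Volume of balls\<close>

text \<open>Slices of a Heisenberg ball over a fixed complex part have this form; \<open>max\<close>
  also covers the empty slice.\<close>

lemma emeasure_lborel_quadratic:
  "emeasure lborel {t::real. k + (t - b)\<^sup>2 < q} = ennreal (2 * sqrt (max 0 (q - k)))"
proof (cases "k < q")
  case True
  have "{t::real. k + (t - b)\<^sup>2 < q} = {b - sqrt (q - k) <..< b + sqrt (q - k)}"
  proof (rule set_eqI)
    fix t
    have "k + (t - b)\<^sup>2 < q \<longleftrightarrow> sqrt ((t - b)\<^sup>2) < sqrt (q - k)"
      by (subst real_sqrt_less_iff) auto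
    then show "t \<in> {t. k + (t - b)\<^sup>2 < q} \<longleftrightarrow> t \<in> {b - sqrt (q - k) <..< b + sqrt (q - k)}"
      by (auto simp: abs_less_iff)
  qed
  then show ?thesis using True by simp
next
  case False
  then have "{t::real. k + (t - b)\<^sup>2 < q} = {}"
    by (auto simp: not_less) (smt (verit) zero_le_power2)
  then show ?thesis using False by simp
qed

text \<open>Tonelli over the complex part: dilating it contributes \<open>r ^ (2n)\<close>, and the
  slice lengths contribute \<open>r\<^sup>2\<close>.\<close>

lemma emeasure_hball_scale:
  fixes u :: "'n::finite heis"
  assumes "r > 0"
  shows "emeasure lebesgue (hball u r)
    = ennreal (r ^ (2 * CARD('n) + 2)) *
      (\<integral>\<^sup>+w. ennreal (2 * sqrt (max 0 (1 - norm (w :: complex ^ 'n) ^ 4))) \<partial>lborel)"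
proof -
  let ?g = "\<lambda>w::complex ^ 'n. 2 * sqrt (max 0 (1 - norm w ^ 4))"
  let ?h = "\<lambda>z::complex ^ 'n. 2 * sqrt (max 0 (r ^ 4 - norm (z - fst u) ^ 4))"
  have slice: "emeasure lborel (Pair z -` hball u r) = ennreal (?h z)" for z :: "complex ^ 'n"
  proof -
    \<comment> \<open>The twist of the group law only moves the midpoint of the slice, not its
      length.\<close>
    have "Pair z -` hball u r
      = {t. norm (z - fst u) ^ 4 + (t - (snd u - 2 * Im (hdot (- fst u) z)))\<^sup>2 < r ^ 4}"
      using assms by (simp add: hball_def hnorm_less_iff hmult_def hinv_def vimage_def algebra_simps)
    then show ?thesis by (simp add: emeasure_lborel_quadratic)
  qed
  have scale: "?h (fst u + r *\<^sub>R w) = r\<^sup>2 * ?g w" for w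
  proof -
    have "r ^ 4 - norm (r *\<^sub>R w) ^ 4 = (r\<^sup>2)\<^sup>2 * (1 - norm w ^ 4)"
      using assms by (simp add: power_mult_distrib algebra_simps)
    then have "max 0 (r ^ 4 - norm (r *\<^sub>R w) ^ 4) = (r\<^sup>2)\<^sup>2 * max 0 (1 - norm w ^ 4)"
      by (simp add: max_mult_distrib_left)
    then have "sqrt (max 0 (r ^ 4 - norm (r *\<^sub>R w) ^ 4)) = r\<^sup>2 * sqrt (max 0 (1 - norm w ^ 4))"
      by (simp only: real_sqrt_mult real_sqrt_abs abs_power2)
    then show ?thesis by simp
  qed
  have sets: "hball u r \<in> sets (lborel \<Otimes>\<^sub>M lborel)"
    unfolding lborel_prod sets_lborel by (rule borel_open[OF open_hball])
  have "emeasure lebesgue (hball u r) = emeasure (lborel \<Otimes>\<^sub>M lborel) (hball u r)"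
    by (simp add: lborel_prod)
  also have "\<dots> = (\<integral>\<^sup>+z. ennreal (?h z) \<partial>lborel)"
    by (subst lborel.emeasure_pair_measure_alt[OF sets]) (simp add: slice)
  also have "\<dots> = (\<integral>\<^sup>+z. ennreal (?h z)
      \<partial>density (distr lborel borel (\<lambda>w. fst u + r *\<^sub>R w)) (\<lambda>_. \<bar>r\<bar> ^ DIM(complex ^ 'n)))"
    using assms by (subst lborel_affine[of r "fst u"]) auto
  also have "\<dots> = ennreal (r ^ (2 * CARD('n))) * (\<integral>\<^sup>+w. ennreal (?h (fst u + r *\<^sub>R w)) \<partial>lborel)"
    using assms by (subst nn_integral_density) (auto simp: nn_integral_distr nn_integral_cmult mult.commute)
  also have "\<dots> = ennreal (r ^ (2 * CARD('n))) * (ennreal (r\<^sup>2) * (\<integral>\<^sup>+w. ennreal (?g w) \<partial>lborel))"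
    unfolding scale by (simp add: ennreal_mult nn_integral_cmult)
  moreover have "ennreal (r ^ (2 * CARD('n) + 2)) = ennreal (r ^ (2 * CARD('n))) * ennreal (r\<^sup>2)"
    using assms by (subst ennreal_mult[symmetric]) (simp_all add: power_add power2_eq_square)
  ultimately show ?thesis
    by (simp only: mult.assoc)
qed

text \<open>The integral in the scaling formula is the volume of the unit ball, which is finite
  because that ball lies in a compact product.\<close>

lemma emeasure_hball:
  fixes u :: "'n::finite heis"
  assumes "r > 0"
  shows "emeasure lebesgue (hball u r)
    = ennreal (r ^ (2 * CARD('n) + 2) * measure lebesgue (hball (0 :: 'n heis) 1))"
proof -
  let ?I = "\<integral>\<^sup>+w. ennreal (2 * sqrt (max 0 (1 - norm (w :: complex ^ 'n) ^ 4))) \<partial>lborel"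
  have I: "emeasure lebesgue (hball (0 :: 'n heis) 1) = ?I"
    using emeasure_hball_scale[of 1 "0 :: 'n heis"] by simp
  have "hball (0 :: 'n heis) 1 \<subseteq> cball 0 1 \<times> cball 0 1"
  proof
    fix v :: "'n heis" assume "v \<in> hball 0 1"
    then have "norm (fst v) ^ 4 + (snd v)\<^sup>2 < 1"
      by (simp add: hball_def hnorm_less_iff hmult_def hinv_def hdot_def)
    then have "norm (fst v) ^ 4 < 1" "(snd v)\<^sup>2 < 1"
      by (smt (verit) zero_le_power norm_ge_zero zero_le_power2)+
    then have "norm (fst v) < 1" "\<bar>snd v\<bar> < 1"
      by (auto simp: power_less_one_iff abs_square_less_1)
    then show "v \<in> cball 0 1 \<times> cball 0 1"
      by (cases v) auto
  qed
  then have "emeasure lebesgue (hball (0 :: 'n heis) 1) \<le> emeasure lebesgue (cball (0::complex^'n) 1 \<times> cball (0::real) 1)"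
    by (intro emeasure_mono fmeasurableD lmeasurable_compact compact_Times) auto
  also have "\<dots> < \<infinity>"
    using emeasure_compact_finite[OF compact_Times[OF compact_cball[of "0::complex^'n" 1] compact_cball[of "0::real" 1]]]
    by (simp add: closed_Times)
  finally have "?I = ennreal (measure lebesgue (hball (0 :: 'n heis) 1))"
    unfolding I[symmetric] by (intro emeasure_eq_ennreal_measure) auto
  then show ?thesis
    using assms by (subst emeasure_hball_scale) (simp_all only: ennreal_mult zero_le_power less_imp_le measure_nonneg)
qed

lemma measure_hball:
  fixes u :: "'n::finite heis"
  assumes "r > 0"
  shows "measure lebesgue (hball u r)
    = r ^ (2 * CARD('n) + 2) * measure lebesgue (hball (0 :: 'n heis) 1)"
  unfolding measure_def[of _ "hball u r"] emeasure_hball[OF assms]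
  using assms by (intro enn2real_ennreal mult_nonneg_nonneg zero_le_power) auto

lemma emeasure_hball_eq_measure: "emeasure lebesgue (hball u r) = ennreal (measure lebesgue (hball u r))"
proof (cases "r > 0")
  case True
  show ?thesis
    unfolding measure_hball[OF True, of u] emeasure_hball[OF True, of u] ..
qed (simp add: hball_empty)

lemma measure_hball_pos:
  assumes "r > 0"
  shows "measure lebesgue (hball u r) > 0"
proof -
  have "\<not> negligible (hball u r)"
    using assms centre_in_hball[of u r] by (intro open_not_negligible) (auto simp del: centre_in_hball)
  then have "emeasure lebesgue (hball u r) \<noteq> 0"
    by (auto simp: negligible_iff_null_sets null_sets_def)
  then show ?thesis
    using emeasure_hball_eq_measure[of u r] by (simp add: zero_less_measure_iff)
qed

lemma measure_hball_scale:
  fixes u v :: "'n::finite heis"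
  assumes "r > 0" "c > 0"
  shows "measure lebesgue (hball v (c * r)) = c ^ (2 * CARD('n) + 2) * measure lebesgue (hball u r)"
proof -
  have "c * r > 0" using assms by simp
  then show ?thesis
    unfolding measure_hball[OF assms(1), of u] measure_hball[OF \<open>c * r > 0\<close>, of v]
    by (simp only: power_mult_distrib mult.assoc)
qed

text \<open>Volumes depend on the radius alone. Different centres are allowed because a ball around
  \<open>u\<close> is later compared with a smaller test ball centred elsewhere.\<close>

lemma measure_hball_mono:
  fixes u v :: "'n::finite heis"
  assumes "0 < r" "r \<le> s"
  shows "measure lebesgue (hball u r) \<le> measure lebesgue (hball v s)"
proof -
  have "0 < s" using assms by simp
  then show ?thesis
    unfolding measure_hball[OF assms(1), of u] measure_hball[OF \<open>0 < s\<close>, of v]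
    using assms by (intro mult_right_mono power_mono) auto
qed

section \<open>A covering theorem\<close>

text \<open>Greedy selection: take a ball of largest radius, discard every ball meeting it, and
  recurse on the rest.\<close>

lemma hball_Vitali_finite:
  assumes "finite K" "\<And>p. p \<in> K \<Longrightarrow> snd p > 0"
  shows "\<exists>C\<subseteq>K. disjoint_family_on (\<lambda>p. hball (fst p) (snd p)) C \<and>
    (\<Union>p\<in>K. hball (fst p) (snd p)) \<subseteq> (\<Union>p\<in>C. hball (fst p) (3 * snd p))"
  using assms
proof (induction "card K" arbitrary: K rule: less_induct)
  case less
  let ?b = "\<lambda>p. hball (fst p) (snd p)"
  show ?case
  proof (cases "K = {}")
    case False
    then have "Max (snd ` K) \<in> snd ` K"
      using less.prems(1) by simp
    then obtain p where p: "p \<in> K" "Max (snd ` K) = snd p"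
      by (rule imageE) blast
    have max: "snd q \<le> snd p" if "q \<in> K" for q
      unfolding p(2)[symmetric] using that less.prems(1) by simp
    define K' where "K' = {q\<in>K. ?b q \<inter> ?b p = {}}"
    have "p \<notin> K'"
      using less.prems(2)[OF p(1)] centre_in_hball[of "fst p" "snd p"] unfolding K'_def by blast
    then have "K' \<subset> K"
      using p(1) by (auto simp: K'_def)
    then have "card K' < card K"
      using less.prems(1) by (rule psubset_card_mono[rotated])
    moreover have "finite K'" "\<And>q. q \<in> K' \<Longrightarrow> snd q > 0"
      using less.prems by (auto simp: K'_def)
    ultimately have "\<exists>C\<subseteq>K'. disjoint_family_on ?b C \<and> (\<Union>q\<in>K'. ?b q) \<subseteq> (\<Union>q\<in>C. hball (fst q) (3 * snd q))"
      by (rule less.hyps)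
    then obtain C where C: "C \<subseteq> K'" "disjoint_family_on ?b C"
      "(\<Union>q\<in>K'. ?b q) \<subseteq> (\<Union>q\<in>C. hball (fst q) (3 * snd q))"
      by (elim exE conjE)
    \<comment> \<open>A ball meeting the chosen one has no larger radius, so it reaches at most
      \<open>snd p + 2 * snd q \<le> 3 * snd p\<close> from the chosen centre.\<close>
    have "?b q \<subseteq> hball (fst p) (3 * snd p)" if q: "q \<in> K" "q \<notin> K'" for q
    proof -
      obtain w where "w \<in> ?b q" "w \<in> ?b p"
        using q unfolding K'_def by blast
      then have "hdist (fst p) (fst q) < snd p + snd q"
        using hdist_triangle[of "fst p" "fst q" w] hdist_commute[of w "fst q"]
        by (simp add: hball_eq_hdist)
      then show ?thesis
        using max[OF q(1)] by (intro hball_subset) linarith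
    qed
    then have "?b q \<subseteq> hball (fst p) (3 * snd p) \<union> (\<Union>q\<in>K'. ?b q)" if "q \<in> K" for q
      using that by blast
    then have "(\<Union>q\<in>K. ?b q) \<subseteq> hball (fst p) (3 * snd p) \<union> (\<Union>q\<in>K'. ?b q)"
      by (rule UN_least)
    also have "\<dots> \<subseteq> (\<Union>q\<in>insert p C. hball (fst q) (3 * snd q))"
      using C(3) unfolding UN_insert by (rule Un_mono[OF order_refl])
    finally have "(\<Union>q\<in>K. ?b q) \<subseteq> (\<Union>q\<in>insert p C. hball (fst q) (3 * snd q))" .
    moreover have "disjoint_family_on ?b (insert p C)"
    proof -
      have "?b q \<inter> ?b p = {}" if "q \<in> C" for q
        using that C(1) unfolding K'_def by blast
      then show ?thesis
        using C(2) unfolding disjoint_family_on_def by blast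
    qed
    moreover have "insert p C \<subseteq> K"
      using C(1) p(1) by (auto simp: K'_def)
    ultimately show ?thesis by blast
  qed (auto simp: disjoint_family_on_def)
qed

text \<open>Tripling the selected balls costs the factor \<open>3 ^ Q\<close>; their disjointness
  lets the lower bounds on the averages add up to one integral over \<open>D\<close>.\<close>

lemma hball_covering_finite:
  fixes h :: "'n::finite heis \<Rightarrow> ennreal"
  assumes K: "finite K" "\<And>p. p \<in> K \<Longrightarrow> snd p > 0"
    and avg: "\<And>p. p \<in> K \<Longrightarrow> l * emeasure lebesgue (hball (fst p) (snd p))
        \<le> set_nn_integral lebesgue (hball (fst p) (snd p)) h"
    and D: "\<And>p. p \<in> K \<Longrightarrow> hball (fst p) (snd p) \<subseteq> D"
    and h [measurable]: "h \<in> borel_measurable lebesgue"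
  shows "l * emeasure lebesgue (\<Union>p\<in>K. hball (fst p) (snd p))
    \<le> ennreal (3 ^ (2 * CARD('n) + 2)) * set_nn_integral lebesgue D h"
proof -
  let ?b = "\<lambda>p. hball (fst p) (snd p)" and ?d = "3 ^ (2 * CARD('n) + 2) :: real"
  have "\<exists>C\<subseteq>K. disjoint_family_on ?b C \<and> (\<Union>p\<in>K. ?b p) \<subseteq> (\<Union>p\<in>C. hball (fst p) (3 * snd p))"
    using K by (rule hball_Vitali_finite)
  then obtain C where C: "C \<subseteq> K" "disjoint_family_on ?b C"
    "(\<Union>p\<in>K. ?b p) \<subseteq> (\<Union>p\<in>C. hball (fst p) (3 * snd p))"
    by (elim exE conjE)
  have fin: "finite C"
    using C(1) K(1) by (rule finite_subset)
  have "emeasure lebesgue (\<Union>p\<in>K. ?b p) \<le> (\<Sum>p\<in>C. emeasure lebesgue (hball (fst p) (3 * snd p)))"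
    using C(3) fin by (intro order_trans[OF emeasure_mono emeasure_subadditive_finite]) auto
  also have "\<dots> = (\<Sum>p\<in>C. ennreal ?d * emeasure lebesgue (?b p))"
  proof (rule sum.cong)
    fix p assume "p \<in> C"
    then have p: "snd p > 0" using C(1) K(2) by blast
    show "emeasure lebesgue (hball (fst p) (3 * snd p)) = ennreal ?d * emeasure lebesgue (?b p)"
      unfolding emeasure_hball_eq_measure
        measure_hball_scale[OF p zero_less_numeral, of "fst p" _ "fst p"]
      by (rule ennreal_mult) simp_all
  qed simp
  finally have "l * emeasure lebesgue (\<Union>p\<in>K. ?b p) \<le> l * (\<Sum>p\<in>C. ennreal ?d * emeasure lebesgue (?b p))"
    by (rule mult_left_mono) simp
  also have "\<dots> = ennreal ?d * (\<Sum>p\<in>C. l * emeasure lebesgue (?b p))"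
    unfolding sum_distrib_left by (intro sum.cong refl mult.left_commute)
  also have "\<dots> \<le> ennreal ?d * (\<Sum>p\<in>C. set_nn_integral lebesgue (?b p) h)"
    using C(1) by (intro mult_left_mono sum_mono avg) auto
  also have "(\<Sum>p\<in>C. set_nn_integral lebesgue (?b p) h) = set_nn_integral lebesgue (\<Union>p\<in>C. ?b p) h"
    using fin C(2) by (subst nn_integral_sum[symmetric])
      (simp_all add: indicator_UN_disjoint sum_distrib_left)
  also have "\<dots> \<le> set_nn_integral lebesgue D h"
  proof (rule nn_set_integral_set_mono)
    show "(\<Union>p\<in>C. ?b p) \<subseteq> D"
      using C(1) D by (intro UN_least) blast
  qed
  finally show ?thesis
    by (simp add: mult_left_mono)
qed

text \<open>The finite bound is uniform in the number of balls. Lindelof gives a countable subfamily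
  with the same union, and continuity from below passes to the limit along its finite initial
  segments.\<close>

lemma hball_covering:
  fixes h :: "'n::finite heis \<Rightarrow> ennreal"
  assumes F: "\<And>p. p \<in> F \<Longrightarrow> snd p > 0"
    and avg: "\<And>p. p \<in> F \<Longrightarrow> l * emeasure lebesgue (hball (fst p) (snd p))
        \<le> set_nn_integral lebesgue (hball (fst p) (snd p)) h"
    and D: "\<And>p. p \<in> F \<Longrightarrow> hball (fst p) (snd p) \<subseteq> D"
    and h: "h \<in> borel_measurable lebesgue"
  shows "l * emeasure lebesgue (\<Union>p\<in>F. hball (fst p) (snd p))
    \<le> ennreal (3 ^ (2 * CARD('n) + 2)) * set_nn_integral lebesgue D h"
proof (cases "F = {}")
  case False
  let ?b = "\<lambda>p. hball (fst p) (snd p)"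
  obtain G where G: "G \<subseteq> ?b ` F" "countable G" "\<Union>G = \<Union>(?b ` F)"
  proof (rule Lindelof[of "?b ` F"])
    show "open S" if "S \<in> ?b ` F" for S
      using that by (elim imageE) simp
  qed (rule that)
  obtain F' where F': "countable F'" "F' \<subseteq> F" "G = ?b ` F'"
    using countable_subset_image[of G ?b F] G by auto
  show ?thesis
  proof (cases "F' = {}")
    case True
    then show ?thesis using F' G by simp
  next
    case ne: False
    let ?e = "from_nat_into F'"
    have e: "?e i \<in> F" for i
      using from_nat_into[OF ne] F'(2) by blast
    have range: "F' = (\<Union>n. ?e ` {..<n})"
      using range_from_nat_into[OF ne F'(1)] by (simp add: UN_lessThan_UNIV flip: image_UN)
    have "(\<Union>p\<in>F. ?b p) = (\<Union>p\<in>F'. ?b p)"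
      using G(3) F'(3) by simp
    also have "\<dots> = (\<Union>n. \<Union>p\<in>?e ` {..<n}. ?b p)"
      by (subst range) (rule UN_UN_flatten)
    finally have "(\<Union>p\<in>F. ?b p) = (\<Union>n. \<Union>p\<in>?e ` {..<n}. ?b p)" .
    moreover have "(SUP n. emeasure lebesgue (\<Union>p\<in>?e ` {..<n}. ?b p))
      = emeasure lebesgue (\<Union>n. \<Union>p\<in>?e ` {..<n}. ?b p)"
    proof (rule SUP_emeasure_incseq)
      show "incseq (\<lambda>n. \<Union>p\<in>?e ` {..<n}. ?b p)"
        unfolding incseq_def by (intro allI impI UN_mono image_mono) auto
      show "range (\<lambda>n. \<Union>p\<in>?e ` {..<n}. ?b p) \<subseteq> sets lebesgue"
        by (intro image_subsetI sets.finite_UN) auto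
    qed
    ultimately have "l * emeasure lebesgue (\<Union>p\<in>F. ?b p)
      = l * (SUP n. emeasure lebesgue (\<Union>p\<in>?e ` {..<n}. ?b p))"
      by (simp only:)
    also have "\<dots> = (SUP n. l * emeasure lebesgue (\<Union>p\<in>?e ` {..<n}. ?b p))"
      by (rule SUP_mult_left_ennreal)
    also have "\<dots> \<le> ennreal (3 ^ (2 * CARD('n) + 2)) * set_nn_integral lebesgue D h"
      using e by (intro SUP_least hball_covering_finite F avg D h) auto
    finally show ?thesis .
  qed
qed simp

section \<open>Measurability\<close>

text \<open>Lower semicontinuity in centre and radius jointly: a point of the limit ball eventually
  lies in the approximating balls, because the defining inequality is strict, and Fatou's lemma does
  the rest.\<close>

lemma open_nn_integral_hball_greater:
  fixes h :: "'n::finite heis \<Rightarrow> ennreal"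
  assumes [measurable]: "h \<in> borel_measurable lebesgue"
  shows "open {p. a < set_nn_integral lebesgue (hball (fst p) (snd p)) h}"
proof -
  let ?I = "\<lambda>p. set_nn_integral lebesgue (hball (fst p) (snd p)) h"
  have "closed {p. ?I p \<le> a}"
    unfolding closed_sequential_limits
  proof (intro allI impI, elim conjE)
    fix x :: "nat \<Rightarrow> 'n heis \<times> real" and l
    assume x: "\<forall>n. x n \<in> {p. ?I p \<le> a}" and lim: "x \<longlonglongrightarrow> l"
    have "h v * indicator (hball (fst l) (snd l)) v
        \<le> liminf (\<lambda>n. h v * indicator (hball (fst (x n)) (snd (x n))) v)" for v
    proof (cases "v \<in> hball (fst l) (snd l)")
      case True
      have "open {p. hdist (fst p) v < snd p}"
        by (intro open_Collect_less continuous_intros)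
      then have "\<forall>\<^sub>F n in sequentially. x n \<in> {p. hdist (fst p) v < snd p}"
        by (rule topological_tendstoD[OF lim]) (use True in \<open>simp add: hball_eq_hdist\<close>)
      then show ?thesis
        using True by (intro Liminf_bounded) (auto elim!: eventually_mono simp: hball_eq_hdist)
    qed simp
    then have "?I l \<le> (\<integral>\<^sup>+v. liminf (\<lambda>n. h v * indicator (hball (fst (x n)) (snd (x n))) v) \<partial>lebesgue)"
      by (intro nn_integral_mono)
    also have "\<dots> \<le> liminf (\<lambda>n. ?I (x n))"
      by (intro nn_integral_liminf) measurable
    also have "\<dots> \<le> liminf (\<lambda>n. a)"
      using x by (intro Liminf_mono always_eventually) auto
    finally show "l \<in> {p. ?I p \<le> a}"
      by (simp add: Liminf_const)
  qed
  then have "open (- {p. ?I p \<le> a})"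
    by (rule open_Compl)
  then show ?thesis
    by (simp add: Compl_eq not_le)
qed

text \<open>Sections of the joint open set: in the centre for measurability, in the radius for the
  passage to rational radii.\<close>

lemma open_nn_integral_hball_greater':
  fixes h :: "'n::finite heis \<Rightarrow> ennreal"
  assumes "h \<in> borel_measurable lebesgue"
  shows "open {u. a < set_nn_integral lebesgue (hball u r) h}"
    and "open {r. a < set_nn_integral lebesgue (hball u r) h}"
proof -
  note op = open_nn_integral_hball_greater[OF assms, of a]
  have "open ((\<lambda>u. (u, r)) -` {p. a < set_nn_integral lebesgue (hball (fst p) (snd p)) h})"
    by (intro open_vimage[OF op] continuous_intros)
  then show "open {u. a < set_nn_integral lebesgue (hball u r) h}"
    by (simp add: vimage_def)
  have "open ((\<lambda>r. (u, r)) -` {p. a < set_nn_integral lebesgue (hball (fst p) (snd p)) h})"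
    by (intro open_vimage[OF op] continuous_intros)
  then show "open {r. a < set_nn_integral lebesgue (hball u r) h}"
    by (simp add: vimage_def)
qed

lemma measurable_nn_integral_hball [measurable]:
  fixes h :: "'n::finite heis \<Rightarrow> ennreal"
  assumes "h \<in> borel_measurable lebesgue"
  shows "(\<lambda>u. set_nn_integral lebesgue (hball u r) h) \<in> borel_measurable lebesgue"
  using open_nn_integral_hball_greater'(1)[OF assms, of _ r]
  by (intro measurable_completion borel_measurableI_greater) auto

text \<open>\<open>Sup\<close> on the reals is a \<open>LEAST\<close> over upper bounds. Without any
  upper bound the predicate is constantly false, hence the same for all such sets.\<close>

lemma Sup_real_not_bdd_above: "\<not> bdd_above S \<Longrightarrow> Sup S = Sup (UNIV :: real set)"
  unfolding Sup_real_def bdd_above_def by (metis UNIV_I)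

text \<open>
  By lower semicontinuity of the integral in \<open>(u, r)\<close>, the set of points \<open>u\<close> admitting a radius in a
  compact interval with \<open>r\<^bsup>2 - Q\<^esup> \<integral> V \<le> 1\<close> is the projection of a closed set along a compact
  factor, hence closed. For an empty or unbounded set of radii \<open>Sup\<close> is an unspecified real, but
  one that does not depend on \<open>u\<close>.
\<close>
lemma borel_measurable_crit_radius:
  fixes V :: "'n::finite heis \<Rightarrow> real"
  assumes nonneg: "\<And>v. V v \<ge> 0"
    and int: "\<And>u r. set_integrable lebesgue (hball u r) V"
    and [measurable]: "V \<in> borel_measurable lebesgue"
  shows "crit_radius V \<in> borel_measurable lebesgue"
proof -
  define G where "G u r = (LINT v:hball u r|lebesgue. V v)" for u r
  let ?Q = "Qdim TYPE('n)"
  have G: "ennreal (G u r) = set_nn_integral lebesgue (hball u r) (\<lambda>v. ennreal (V v))" for u r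
    unfolding G_def set_lebesgue_integral_def nn_integral_set_ennreal using int[of u r] nonneg
    by (subst nn_integral_eq_integral[symmetric]) (auto simp: set_integrable_def mult.commute)
  have G0: "G u r \<ge> 0" for u r
    unfolding G_def set_lebesgue_integral_def using nonneg by (intro integral_nonneg_AE) auto
  have open_G: "open {p. c < G (fst p) (snd p)}" for c
  proof (cases "c \<ge> 0")
    case True
    then have "{p. c < G (fst p) (snd p)} = {p. ennreal c < ennreal (G (fst p) (snd p))}"
      by (simp add: ennreal_less_iff)
    then show ?thesis
      unfolding G using open_nn_integral_hball_greater[of "\<lambda>v. ennreal (V v)" "ennreal c"] by simp
  next
    case False
    then have "{p. c < G (fst p) (snd p)} = UNIV"
      using G0 by (auto simp: not_le intro: less_le_trans)
    then show ?thesis by simp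
  qed
  have closed_G: "closed {u. \<exists>r\<in>{b..c}. G u r \<le> r powr (?Q - 2)}" if "b > 0" for b c
  proof -
    \<comment> \<open>Cutting off at \<open>b > 0\<close> makes the power continuous on the whole
      space without changing it for radii in the compact interval.\<close>
    define \<psi> where "\<psi> p = (max b (snd p)) powr (?Q - 2)" for p :: "'n heis \<times> real"
    have \<psi>: "continuous_on UNIV \<psi>"
      unfolding \<psi>_def using that by (intro continuous_intros) auto
    \<comment> \<open>A constant inserted between both sides reduces the comparison to the
      superlevel sets of \<open>G\<close>, which are open.\<close>
    have "{p. \<psi> p < G (fst p) (snd p)} = (\<Union>c. {p. \<psi> p < c} \<inter> {p. c < G (fst p) (snd p)})"
      using dense by (auto intro: less_trans)
    moreover have "open \<dots>"
      using \<psi> by (intro open_UN ballI open_Int open_G open_Collect_less) auto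
    ultimately have "open {p. \<psi> p < G (fst p) (snd p)}"
      by simp
    then have "closed (- {p. \<psi> p < G (fst p) (snd p)})"
      by (rule closed_Compl)
    then have "closed (prod.swap -` (- {p. \<psi> p < G (fst p) (snd p)}))"
      by (rule closed_vimage) (intro continuous_intros)
    from closed_compact_projection[OF compact_Icc[of b c] this]
    have "closed {u. \<exists>r\<in>{b..c}. (u, r) \<in> - {p. \<psi> p < G (fst p) (snd p)}}"
      by (simp add: Bex_def)
    moreover have "{u. \<exists>r\<in>{b..c}. (u, r) \<in> - {p. \<psi> p < G (fst p) (snd p)}}
      = {u. \<exists>r\<in>{b..c}. G u r \<le> r powr (?Q - 2)}"
      by (auto simp: \<psi>_def not_less)
    ultimately show ?thesis by simp
  qed
  define P where "P a u \<longleftrightarrow> (\<exists>r>a. G u r \<le> r powr (?Q - 2))" for a u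
  have P [measurable]: "Measurable.pred borel (P a)" if "a \<ge> 0" for a
  proof -
    \<comment> \<open>The open half-line above \<open>a\<close> is exhausted by compact intervals
      with positive left end, as the closedness result demands.\<close>
    have "{u. P a u} = (\<Union>n. {u. \<exists>r\<in>{a + 1 / real (Suc n) .. a + real n}. G u r \<le> r powr (?Q - 2)})"
    proof (intro set_eqI iffI)
      fix u assume "u \<in> {u. P a u}"
      then obtain r where r: "r > a" "G u r \<le> r powr (?Q - 2)"
        by (auto simp: P_def)
      obtain k l where k: "inverse (real (Suc k)) < r - a" and l: "r - a < real l"
        using reals_Archimedean[of "r - a"] reals_Archimedean2[of "r - a"] r(1) by auto
      have "1 / real (Suc (max k l)) \<le> inverse (real (Suc k))"
        by (simp add: divide_simps)
      then have "r \<in> {a + 1 / real (Suc (max k l)) .. a + real (max k l)}"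
        using k l by auto
      with r(2) show "u \<in> (\<Union>n. {u. \<exists>r\<in>{a + 1 / real (Suc n) .. a + real n}. G u r \<le> r powr (?Q - 2)})"
        by blast
    next
      fix u assume "u \<in> (\<Union>n. {u. \<exists>r\<in>{a + 1 / real (Suc n) .. a + real n}. G u r \<le> r powr (?Q - 2)})"
      then obtain n r where r: "r \<ge> a + 1 / real (Suc n)" "G u r \<le> r powr (?Q - 2)"
        by auto
      have "a < a + 1 / real (Suc n)" by simp
      also note r(1)
      finally show "u \<in> {u. P a u}"
        using r(2) unfolding P_def by blast
    qed
    also have "\<dots> \<in> sets borel"
      using that by (intro sets.countable_UN image_subsetI borel_closed closed_G)
        (auto intro: add_nonneg_pos)
    finally show ?thesis
      by (simp add: pred_def)
  qed
  define S where "S u = {r. r > 0 \<and> G u r \<le> r powr (?Q - 2)}" for u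
  have S: "crit_radius V u = Sup (S u)" for u
  proof -
    have "r powr (2 - ?Q) * G u r \<le> 1 \<longleftrightarrow> G u r \<le> r powr (?Q - 2)" if "r > 0" for r
    proof -
      have "r powr (2 - ?Q) = inverse (r powr (?Q - 2))"
        by (simp add: powr_minus[symmetric])
      moreover have "inverse x * G u r \<le> 1 \<longleftrightarrow> G u r \<le> x" if "x > 0" for x
        using that by (simp add: field_simps)
      ultimately show ?thesis
        using that by simp
    qed
    then show ?thesis
      unfolding crit_radius_def S_def G_def[symmetric] by (intro arg_cong[where f = Sup]) auto
  qed
  \<comment> \<open>\<open>P 0\<close> detects whether there is any admissible radius, and
    \<open>P n\<close> for all \<open>n\<close> detects unboundedness. In the remaining case
    \<open>max a 0\<close> accounts for negative \<open>a\<close>, since only positive radii are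
    admissible.\<close>
  have greater: "a < crit_radius V u \<longleftrightarrow>
      (if \<not> P 0 u then a < Sup {} else if \<forall>n::nat. P (real n) u then a < Sup (UNIV :: real set)
       else P (max a 0) u)" for a u
  proof -
    have empty: "S u = {} \<longleftrightarrow> \<not> P 0 u"
      by (auto simp: S_def P_def)
    have bdd: "bdd_above (S u) \<longleftrightarrow> \<not> (\<forall>n::nat. P (real n) u)"
    proof
      assume "bdd_above (S u)"
      then obtain M where M: "\<And>r. r \<in> S u \<Longrightarrow> r \<le> M"
        by (auto simp: bdd_above_def)
      obtain n where "M < real n"
        using reals_Archimedean2 by auto
      then have "\<not> P (real n) u"
        using M unfolding P_def S_def mem_Collect_eq by (smt (verit) of_nat_0_le_iff)
      then show "\<not> (\<forall>n::nat. P (real n) u)" by blast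
    next
      assume "\<not> (\<forall>n::nat. P (real n) u)"
      then obtain n where "\<not> P (real n) u" by blast
      then show "bdd_above (S u)"
        by (intro bdd_aboveI[of _ "real n"]) (auto simp: S_def P_def not_less intro: leI)
    qed
    show ?thesis
    proof (cases "P 0 u \<and> \<not> (\<forall>n::nat. P (real n) u)")
      case True
      then have "a < Sup (S u) \<longleftrightarrow> (\<exists>r\<in>S u. a < r)"
        using empty bdd by (intro less_cSup_iff) auto
      also have "\<dots> \<longleftrightarrow> P (max a 0) u"
        by (auto simp: S_def P_def)
      finally show ?thesis using True S by auto
    next
      case False
      then show ?thesis
        using empty bdd S Sup_real_not_bdd_above[of "S u"] by auto
    qed
  qed
  have "crit_radius V \<in> borel_measurable borel"
    unfolding borel_measurable_iff_greater
  proof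
    fix a
    have [measurable]: "Measurable.pred borel (P (real n))" "Measurable.pred borel (P 0)"
      "Measurable.pred borel (P (max a 0))" for n :: nat
      by (auto intro: P)
    show "{u \<in> space borel. a < crit_radius V u} \<in> sets borel"
      unfolding greater by measurable
  qed
  then show ?thesis
    by (simp add: measurable_completion)
qed

text \<open>The supremum over all radii is reduced to rational ones, leaving a countable supremum of
  measurable functions.\<close>

lemma borel_measurable_maxop:
  fixes f :: "'n::finite heis \<Rightarrow> real"
  assumes \<rho>: "\<And>u. \<rho> u > 0" and N: "N \<ge> 0"
    and [measurable]: "\<rho> \<in> borel_measurable lebesgue" "f \<in> borel_measurable lebesgue"
  shows "maxop \<rho> N f \<in> borel_measurable lebesgue"
proof -
  let ?h = "\<lambda>v. ennreal \<bar>f v\<bar>"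
  let ?I = "\<lambda>u r. set_nn_integral lebesgue (hball u r) ?h"
  let ?w = "\<lambda>u r. (1 + r / \<rho> u) powr (- N)"
  let ?\<Phi> = "\<lambda>u r. ennreal (?w u r) * (?I u r / emeasure lebesgue (hball u r))"
  \<comment> \<open>The volume does not depend on the centre, so the denominator can be made
    constant in \<open>u\<close>.\<close>
  let ?\<Phi>' = "\<lambda>u r. ennreal (?w u r) * (?I u r / emeasure lebesgue (hball (0 :: 'n heis) r))"
  \<comment> \<open>The averages are lower semicontinuous in the radius and the remaining factor is
    decreasing, so rational radii slightly smaller than \<open>r\<close> suffice.\<close>
  have le: "?\<Phi> u r \<le> (SUP q\<in>\<rat> \<inter> {0<..}. ?\<Phi> u q)" if r: "r > 0" for u r
  proof -
    let ?k = "\<lambda>r. ennreal (?w u r) / emeasure lebesgue (hball u r)"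
    have \<Phi>: "?\<Phi> u q = ?k q * ?I u q" for q
      by (simp add: divide_ennreal_def mult_ac)
    have k: "?k r \<le> ?k q" if "0 < q" "q \<le> r" for q
    proof -
      have "inverse (emeasure lebesgue (hball u r)) \<le> inverse (emeasure lebesgue (hball u q))"
        unfolding emeasure_hball_eq_measure
          inverse_ennreal[OF measure_hball_pos[OF \<open>0 < q\<close>]] inverse_ennreal[OF measure_hball_pos[OF r]]
        by (intro ennreal_leI le_imp_inverse_le measure_hball_mono measure_hball_pos that)
      moreover have "?w u r \<le> ?w u q"
        using that \<rho>[of u] N by (intro powr_mono2') (auto simp: divide_right_mono add_pos_pos)
      ultimately show ?thesis
        unfolding divide_ennreal_def by (intro mult_mono ennreal_leI) auto
    qed
    have "?I u r \<le> (SUP q\<in>\<rat> \<inter> {0<..<r}. ?I u q)"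
    proof (rule dense_le)
      fix c assume c: "c < ?I u r"
      have "open {x. c < ?I u x}"
        by (rule open_nn_integral_hball_greater'(2)) measurable
      then obtain e where e: "e > 0" "ball r e \<subseteq> {x. c < ?I u x}"
        using c unfolding open_contains_ball by blast
      obtain q where q: "q \<in> \<rat>" "max 0 (r - e) < q" "q < r"
        using Rats_dense_in_real[of "max 0 (r - e)" r] r e(1) by auto
      then have "c < ?I u q"
        using e(2) by (auto simp: subset_iff dist_real_def)
      then show "c \<le> (SUP q\<in>\<rat> \<inter> {0<..<r}. ?I u q)"
        using q by (intro SUP_upper2[of q]) auto
    qed
    then have "?\<Phi> u r \<le> ?k r * (SUP q\<in>\<rat> \<inter> {0<..<r}. ?I u q)"
      unfolding \<Phi> by (rule mult_left_mono) simp
    also have "\<dots> = (SUP q\<in>\<rat> \<inter> {0<..<r}. ?k r * ?I u q)"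
      by (rule SUP_mult_left_ennreal)
    also have "\<dots> \<le> (SUP q\<in>\<rat> \<inter> {0<..}. ?\<Phi> u q)"
    proof (rule SUP_least)
      fix q assume q: "q \<in> \<rat> \<inter> {0<..<r}"
      have "?k r * ?I u q \<le> ?k q * ?I u q"
        using q by (intro mult_right_mono k) simp_all
      also have "\<dots> \<le> (SUP q\<in>\<rat> \<inter> {0<..}. ?\<Phi> u q)"
        unfolding \<Phi> using q by (intro SUP_upper) simp
      finally show "?k r * ?I u q \<le> (SUP q\<in>\<rat> \<inter> {0<..}. ?\<Phi> u q)" .
    qed
    finally show ?thesis .
  qed
  have "maxop \<rho> N f u = (SUP q\<in>\<rat> \<inter> {0<..}. ?\<Phi>' u q)" for u
  proof -
    have "maxop \<rho> N f u = (SUP q\<in>\<rat> \<inter> {0<..}. ?\<Phi> u q)"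
      unfolding maxop_def by (intro antisym SUP_least le SUP_subset_mono) auto
    also have "\<dots> = (SUP q\<in>\<rat> \<inter> {0<..}. ?\<Phi>' u q)"
    proof (intro SUP_cong refl)
      fix q :: real assume "q \<in> \<rat> \<inter> {0<..}"
      then have "q > 0" by simp
      show "?\<Phi> u q = ?\<Phi>' u q"
        unfolding emeasure_hball[OF \<open>q > 0\<close>, of u] emeasure_hball[OF \<open>q > 0\<close>, of 0] ..
    qed
    finally show ?thesis .
  qed
  moreover have "(\<lambda>u. SUP q\<in>\<rat> \<inter> {0<..}. ?\<Phi>' u q) \<in> borel_measurable lebesgue"
    by (intro borel_measurable_SUP countable_Int1 countable_rat) measurable
  ultimately show ?thesis by presburger
qed

section \<open>The weak type estimate\<close>

lemma powr_nonpos_le_one: "1 \<le> x \<Longrightarrow> a \<le> 0 \<Longrightarrow> x powr a \<le> (1 :: real)"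
  using powr_mono2'[of a 1 x] by simp

text \<open>Used for doubling a radius: with \<open>c = 2\<close> for the weight and
  \<open>c = 2 ^ Q\<close> for the volume.\<close>

lemma powr_minus_scale:
  fixes x c :: real
  assumes "c > 0" "x \<ge> 0"
  shows "x powr (- a) = c powr a * (c * x) powr (- a)"
  using assms by (simp add: powr_mult powr_minus)

text \<open>
  At distance \<open>h < \<bar>\<rho> 0\<bar>\<close> close to \<open>\<bar>\<rho> 0\<bar>\<close> a negative value \<open>\<rho> 0\<close> would make \<open>1 + h / \<rho> 0\<close> tend to
  0, where the lower bound on the quotient blows up while the upper bound does not.
\<close>
lemma slowly_varying_imp_pos:
  fixes \<rho> :: "'n::finite heis \<Rightarrow> real"
  assumes N0: "N0 > 0" and C0: "C0 \<ge> 1"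
    and lower: "\<And>u v. inverse C0 * (1 + hdist v u / \<rho> u) powr (- N0) \<le> \<rho> v / \<rho> u"
    and upper: "\<And>u v. \<rho> v / \<rho> u \<le> C0 * (1 + hdist v u / \<rho> u) powr (N0 / (N0 + 1))"
  shows "\<rho> u > 0"
proof -
  \<comment> \<open>If \<open>\<rho> u = 0\<close>, the quotient is 0 by the convention for
    division, but the lower bound at distance 0 is \<open>inverse C0 > 0\<close>.\<close>
  have nonzero: "\<rho> u \<noteq> 0" for u
    using lower[of u u] C0 by auto
  have quot: "\<rho> v / \<rho> u > 0" for u v
  proof -
    have "0 \<le> inverse C0 * (1 + hdist v u / \<rho> u) powr (- N0)"
      using C0 by simp
    then have "\<rho> v / \<rho> u \<ge> 0"
      using lower[of v u] by linarith
    then show ?thesis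
      using nonzero[of u] nonzero[of v] by (simp add: less_le)
  qed
  have "\<rho> 0 > 0"
  proof (rule ccontr)
    assume "\<not> \<rho> 0 > 0"
    then have neg: "\<rho> 0 < 0" using nonzero[of 0] by simp
    \<comment> \<open>Chosen so that \<open>\<delta> powr (- N0) = 2 * C0\<^sup>2\<close>: the lower
      bound becomes \<open>2 * C0\<close>, while the upper bound stays at most
      \<open>C0\<close>.\<close>
    define \<delta> where "\<delta> = (2 * C0\<^sup>2) powr (- (1 / N0))"
    have C0': "C0\<^sup>2 \<ge> 1" using C0 by simp
    have "2 * C0\<^sup>2 \<ge> 1" "- (1 / N0) \<le> 0"
      using C0' N0 by (linarith, simp)
    then have \<delta>: "0 < \<delta>" "\<delta> \<le> 1"
      using C0 unfolding \<delta>_def by (simp, intro powr_nonpos_le_one)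
    define h where "h = (\<delta> - 1) * \<rho> 0"
    have h: "h \<ge> 0" "1 + h / \<rho> 0 = \<delta>"
      using neg \<delta> by (auto simp: h_def mult_nonpos_nonpos)
    \<comment> \<open>A point on the vertical axis at distance exactly \<open>h\<close> from the
      origin.\<close>
    let ?v = "(0, h\<^sup>2) :: 'n heis"
    have "hdist ?v 0 = (h ^ 4) powr (1 / 4)"
      by (simp add: hdist_def hnorm_def hmult_def hinv_def hdot_def)
    also have "\<dots> = h"
      using h(1) by (cases "h = 0") (simp_all add: powr_powr flip: powr_numeral)
    finally have dist: "hdist ?v 0 = h" .
    have "inverse C0 * \<delta> powr (- N0) \<le> C0 * \<delta> powr (N0 / (N0 + 1))"
      using lower[of ?v 0] upper[of ?v 0] unfolding dist h(2) by linarith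
    also have "\<dots> \<le> C0 * 1"
      using \<delta> N0 C0 by (intro mult_left_mono powr_le1) auto
    also have "\<delta> powr (- N0) = 2 * C0\<^sup>2"
      unfolding \<delta>_def using N0 C0 by (simp add: powr_powr)
    finally show False
      using C0 by (simp add: field_simps power2_eq_square)
  qed
  then show ?thesis
    using quot[of u 0] by (simp add: zero_less_divide_iff)
qed

text \<open>In the constant, \<open>3 ^ Q\<close> comes from the covering, the
  \<open>\<theta>\<close> and \<open>\<kappa>\<close> powers from replacing \<open>r\<close> by
  \<open>2 * r\<close> in the weight and the volume, and the summand 1 from the large radii.\<close>

lemma maxop_weak_bound:
  fixes f :: "'n::finite heis \<Rightarrow> real"
  assumes \<rho>: "\<And>u. \<rho> u > 0" and \<kappa>: "0 < \<kappa>" "\<kappa> < 1" and \<theta>: "0 < \<theta>" "\<theta> \<le> N"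
    and f [measurable]: "f \<in> borel_measurable lebesgue"
  shows "weak_morrey_norm \<rho> \<theta> \<kappa> (maxop \<rho> N f)
    \<le> ennreal (3 ^ (2 * CARD('n) + 2) * (2 powr \<theta> * (2 ^ (2 * CARD('n) + 2)) powr \<kappa>) + 1)
        * morrey_norm \<rho> \<theta> \<kappa> f"
proof -
  let ?h = "\<lambda>v. ennreal \<bar>f v\<bar>" and ?d = "2 * CARD('n) + 2"
  let ?M = "morrey_norm \<rho> \<theta> \<kappa> f"
  let ?m = "\<lambda>u r. measure lebesgue (hball u r)"
  let ?I = "\<lambda>u r. set_nn_integral lebesgue (hball u r) ?h"
  let ?A = "\<lambda>u r. ?I u r / emeasure lebesgue (hball u r)"
  let ?W = "\<lambda>u r. (1 + r / \<rho> u) powr (- \<theta>) * ?m u r powr (- \<kappa>)"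
  let ?c = "2 powr \<theta> * (2 ^ ?d) powr \<kappa> :: real"
  have M: "ennreal (?W u r) * ?I u r \<le> ?M" if "r > 0" for u r
    unfolding morrey_norm_def using that by (intro SUP_upper2[of "(u, r)"]) auto
  have one_le: "1 \<le> 1 + r / \<rho> u" if "r > 0" for u r
    using \<rho>[of u] that by (simp add: less_imp_le)
  have large: "ennreal ((1 + R / \<rho> u) powr (- N)) * ?A u R \<le> ennreal (?m v r powr (\<kappa> - 1)) * ?M"
    if "0 < r" "r \<le> R" for u v :: "'n heis" and r R
  proof -
    have R: "R > 0" using that by simp
    let ?a = "1 + R / \<rho> u"
    \<comment> \<open>Splitting the inverse volume as the powers \<open>\<kappa> - 1\<close> and
      \<open>- \<kappa>\<close> leaves the Morrey weight of the larger ball; the first power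
      decreases in the volume.\<close>
    have "?a powr (- N) * inverse (?m u R) \<le> ?m v r powr (\<kappa> - 1) * ?W u R"
    proof -
      have "inverse (?m u R) = ?m u R powr (\<kappa> - 1) * ?m u R powr (- \<kappa>)"
        using measure_hball_pos[OF R, of u]
        by (simp add: powr_neg_one inverse_eq_divide flip: powr_add)
      also have "\<dots> \<le> ?m v r powr (\<kappa> - 1) * ?m u R powr (- \<kappa>)"
        using \<kappa> that by (intro mult_right_mono powr_mono2' measure_hball_mono measure_hball_pos) auto
      finally have "?a powr (- N) * inverse (?m u R)
          \<le> ?a powr (- \<theta>) * (?m v r powr (\<kappa> - 1) * ?m u R powr (- \<kappa>))"
        using \<theta> one_le[OF R, of u] by (intro mult_mono powr_mono) auto
      then show ?thesis by (simp only: mult_ac)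
    qed
    then have "ennreal (?a powr (- N)) * inverse (emeasure lebesgue (hball u R))
        \<le> ennreal (?m v r powr (\<kappa> - 1)) * ennreal (?W u R)"
      unfolding emeasure_hball_eq_measure inverse_ennreal[OF measure_hball_pos[OF R]]
      by (simp only: ennreal_mult[symmetric] powr_ge_zero inverse_nonnegative_iff_nonnegative
          measure_nonneg mult_nonneg_nonneg ennreal_leI)
    then have "ennreal (?a powr (- N)) * inverse (emeasure lebesgue (hball u R)) * ?I u R
        \<le> ennreal (?m v r powr (\<kappa> - 1)) * ennreal (?W u R) * ?I u R"
      by (rule mult_right_mono) simp
    also have "\<dots> \<le> ennreal (?m v r powr (\<kappa> - 1)) * ?M"
      unfolding mult.assoc by (intro mult_left_mono M R) simp
    finally show ?thesis
      unfolding divide_ennreal_def by (simp only: mult_ac)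
  qed
  have main: "ennreal (?W u0 r) * (ennreal l * emeasure lebesgue {u \<in> hball u0 r. maxop \<rho> N f u > ennreal l})
      \<le> ennreal (3 ^ ?d * ?c + 1) * ?M" (is "_ * (_ * emeasure lebesgue ?E) \<le> _")
    if r: "r > 0" and l: "l > 0" for u0 r l
  proof -
    define F where "F = {p. fst p \<in> hball u0 r \<and> 0 < snd p \<and> snd p \<le> r \<and> ennreal l < ?A (fst p) (snd p)}"
    define U where "U = (\<Union>p\<in>F. hball (fst p) (snd p))"
    \<comment> \<open>The bound for large radii is the same at every point of the ball, so these
      radii contribute either the whole ball or nothing.\<close>
    define T where "T = (if ennreal l < ennreal (?m u0 r powr (\<kappa> - 1)) * ?M then hball u0 r else {})"
    have "?E \<subseteq> U \<union> T"
    proof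
      fix u assume "u \<in> ?E"
      then have u: "u \<in> hball u0 r" and "ennreal l < maxop \<rho> N f u" by auto
      then obtain R where R: "R > 0" "ennreal l < ennreal ((1 + R / \<rho> u) powr (- N)) * ?A u R"
        unfolding maxop_def less_SUP_iff by auto
      show "u \<in> U \<union> T"
      proof (cases "R \<le> r")
        case True
        have "(1 + R / \<rho> u) powr (- N) \<le> 1"
          using one_le[OF R(1), of u] \<theta> by (intro powr_nonpos_le_one) auto
        then have "ennreal ((1 + R / \<rho> u) powr (- N)) * ?A u R \<le> 1 * ?A u R"
          by (intro mult_right_mono) auto
        then have "ennreal l < ?A u R"
          using R(2) by simp
        then have "(u, R) \<in> F"
          using u R(1) True by (simp add: F_def)
        then have "u \<in> U"
          unfolding U_def using R(1) by (intro UN_I[of "(u, R)"]) auto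
        then show ?thesis by blast
      next
        case False
        then have "ennreal l < ennreal (?m u0 r powr (\<kappa> - 1)) * ?M"
          using less_le_trans[OF R(2) large[of r R u u0]] r by simp
        then show ?thesis using u by (simp add: T_def)
      qed
    qed
    moreover have sets: "U \<in> sets lebesgue" "T \<in> sets lebesgue"
    proof -
      have "open U"
        unfolding U_def by (intro open_UN ballI open_hball)
      then show "U \<in> sets lebesgue" by auto
    qed (simp add: T_def)
    ultimately have E: "emeasure lebesgue ?E \<le> emeasure lebesgue U + emeasure lebesgue T"
      by (intro order_trans[OF emeasure_mono emeasure_subadditive]) auto
    have "ennreal (?W u0 r) * (ennreal l * emeasure lebesgue U) \<le> ennreal (3 ^ ?d * ?c) * ?M"
    proof -
      have "ennreal l * emeasure lebesgue U \<le> ennreal (3 ^ ?d) * ?I u0 (2 * r)"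
        unfolding U_def
      proof (rule hball_covering)
        fix p assume p: "p \<in> F"
        then show R: "snd p > 0" by (simp add: F_def)
        have "emeasure lebesgue (hball (fst p) (snd p)) / emeasure lebesgue (hball (fst p) (snd p)) = 1"
          using measure_hball_pos[OF R, of "fst p"] unfolding emeasure_hball_eq_measure
          by (intro ennreal_divide_self) auto
        then have "?A (fst p) (snd p) * emeasure lebesgue (hball (fst p) (snd p)) = ?I (fst p) (snd p)"
          by (simp only: ennreal_divide_times mult_1_right)
        moreover have "ennreal l \<le> ?A (fst p) (snd p)"
          using p unfolding F_def mem_Collect_eq by (intro less_imp_le) blast
        then have "ennreal l * emeasure lebesgue (hball (fst p) (snd p))
            \<le> ?A (fst p) (snd p) * emeasure lebesgue (hball (fst p) (snd p))"
          by (rule mult_right_mono) simp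
        ultimately show "ennreal l * emeasure lebesgue (hball (fst p) (snd p)) \<le> ?I (fst p) (snd p)"
          by (simp only:)
        show "hball (fst p) (snd p) \<subseteq> hball u0 (2 * r)"
          using p by (intro hball_subset) (simp add: F_def hball_eq_hdist)
      qed measurable
      then have "ennreal (?W u0 r) * (ennreal l * emeasure lebesgue U)
          \<le> ennreal (?W u0 r) * (ennreal (3 ^ ?d) * ?I u0 (2 * r))"
        by (rule mult_left_mono) simp
      \<comment> \<open>The normalisation moves from \<open>r\<close> to \<open>2 * r\<close>, since
        \<open>1 + 2 * r / \<rho> u0 \<le> 2 * (1 + r / \<rho> u0)\<close> and the volume grows by
        \<open>2 ^ Q\<close>.\<close>
      also have "\<dots> \<le> ennreal (?c * ?W u0 (2 * r)) * (ennreal (3 ^ ?d) * ?I u0 (2 * r))"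
      proof (intro mult_right_mono ennreal_leI)
        have "(2 * (1 + r / \<rho> u0)) powr (- \<theta>) \<le> (1 + 2 * r / \<rho> u0) powr (- \<theta>)"
          using \<theta> one_le[of "2 * r" u0] r by (intro powr_mono2') auto
        moreover have "(1 + r / \<rho> u0) powr (- \<theta>) = 2 powr \<theta> * (2 * (1 + r / \<rho> u0)) powr (- \<theta>)"
          using one_le[OF r, of u0] by (intro powr_minus_scale) auto
        ultimately have "(1 + r / \<rho> u0) powr (- \<theta>) \<le> 2 powr \<theta> * (1 + 2 * r / \<rho> u0) powr (- \<theta>)"
          by (simp only: mult_left_mono powr_ge_zero)
        moreover have "?m u0 r powr (- \<kappa>) = (2 ^ ?d) powr \<kappa> * ?m u0 (2 * r) powr (- \<kappa>)"
          unfolding measure_hball_scale[OF r zero_less_numeral, of u0 _ u0]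
          by (rule powr_minus_scale) simp_all
        ultimately have "?W u0 r \<le> (2 powr \<theta> * (1 + 2 * r / \<rho> u0) powr (- \<theta>))
            * ((2 ^ ?d) powr \<kappa> * ?m u0 (2 * r) powr (- \<kappa>))"
          by (intro mult_mono) auto
        then show "?W u0 r \<le> ?c * ?W u0 (2 * r)"
          by (simp only: mult_ac)
      qed simp
      also have "\<dots> = ennreal (3 ^ ?d * ?c) * (ennreal (?W u0 (2 * r)) * ?I u0 (2 * r))"
        by (simp only: ennreal_mult powr_ge_zero measure_nonneg mult_nonneg_nonneg zero_le_power
            zero_le_numeral mult_ac)
      also have "\<dots> \<le> ennreal (3 ^ ?d * ?c) * ?M"
        using r by (intro mult_left_mono M) auto
      finally show ?thesis .
    qed
    moreover have "ennreal (?W u0 r) * (ennreal l * emeasure lebesgue T) \<le> ?M"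
    proof (cases "ennreal l < ennreal (?m u0 r powr (\<kappa> - 1)) * ?M")
      case True
      have m: "?m u0 r > 0" by (rule measure_hball_pos[OF r])
      \<comment> \<open>The exponents \<open>- \<kappa>\<close>, \<open>\<kappa> - 1\<close> and 1
        of the volume cancel, leaving only the weight.\<close>
      have "?W u0 r * (?m u0 r powr (\<kappa> - 1) * ?m u0 r) = (1 + r / \<rho> u0) powr (- \<theta>)"
      proof -
        have "?m u0 r powr (- \<kappa>) * (?m u0 r powr (\<kappa> - 1) * ?m u0 r powr 1) = 1"
          using m by (simp only: powr_add[symmetric]) simp
        then show ?thesis using m by (simp add: mult.assoc)
      qed
      also have "\<dots> \<le> 1"
        using one_le[OF r, of u0] \<theta> by (intro powr_nonpos_le_one) auto
      finally have le1: "ennreal (?W u0 r * (?m u0 r powr (\<kappa> - 1) * ?m u0 r)) \<le> 1"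
        by simp
      have "ennreal (?W u0 r) * (ennreal l * emeasure lebesgue T)
          \<le> ennreal (?W u0 r) * ((ennreal (?m u0 r powr (\<kappa> - 1)) * ?M) * ennreal (?m u0 r))"
        using True unfolding T_def emeasure_hball_eq_measure[symmetric]
        by (intro mult_left_mono mult_mono) auto
      also have "\<dots> = ennreal (?W u0 r * (?m u0 r powr (\<kappa> - 1) * ?m u0 r)) * ?M"
        by (simp only: ennreal_mult powr_ge_zero measure_nonneg mult_nonneg_nonneg mult_ac)
      also have "\<dots> \<le> 1 * ?M"
        by (rule mult_right_mono[OF le1]) simp
      finally show ?thesis by simp
    qed (simp add: T_def)
    ultimately have "ennreal (?W u0 r) * (ennreal l * (emeasure lebesgue U + emeasure lebesgue T))
        \<le> ennreal (3 ^ ?d * ?c) * ?M + ?M"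
      unfolding distrib_left by (rule add_mono)
    also have "\<dots> = ennreal (3 ^ ?d * ?c + 1) * ?M"
      by (subst ennreal_plus) (simp_all add: distrib_right)
    finally show ?thesis
      by (rule order_trans[rotated]) (intro mult_left_mono E, simp_all)
  qed
  show ?thesis
    unfolding weak_morrey_norm_def
  proof (intro SUP_least)
    fix ur :: "'n heis \<times> real" assume "ur \<in> UNIV \<times> {0<..}"
    then show "ennreal (?W (fst ur) (snd ur))
        * (SUP l\<in>{0<..}. ennreal l * emeasure lebesgue {u \<in> hball (fst ur) (snd ur). maxop \<rho> N f u > ennreal l})
      \<le> ennreal (3 ^ ?d * ?c + 1) * ?M"
      unfolding SUP_mult_left_ennreal by (intro SUP_least main) auto
  qed
qed

theorem theorem3p4:
  fixes V :: "('n::finite) heis \<Rightarrow> real" and \<kappa> s N0 C0 :: real and N :: nat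
  assumes "0 < \<kappa>" and "\<kappa> < 1"
    and "\<forall>v. V v \<ge> 0"
    and "V \<in> borel_measurable lebesgue"
    and "\<forall>u r. set_integrable lebesgue (hball u r) V"
    and "\<not> (AE v in lebesgue. V v = 0)"
    and "s \<ge> Qdim TYPE('n) / 2" and "RH s V"
    and "N0 > 0" and "C0 \<ge> 1"
    and "\<forall>u v.
       inverse C0 * (1 + hnorm (hmult (hinv v) u) / crit_radius V u) powr (- N0)
          \<le> crit_radius V v / crit_radius V u
       \<and> crit_radius V v / crit_radius V u
          \<le> C0 * (1 + hnorm (hmult (hinv v) u) / crit_radius V u) powr (N0 / (N0 + 1))"
  shows "\<forall>\<theta>::real. 0 < \<theta> \<and> \<theta> * (N0 + 1) \<le> real N \<longrightarrow>
     (\<exists>C::real. C > 0 \<and>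
        (\<forall>f :: 'n heis \<Rightarrow> real. f \<in> borel_measurable lebesgue
            \<and> morrey_norm (crit_radius V) \<theta> \<kappa> f < \<infinity> \<longrightarrow>
          maxop (crit_radius V) (real N) f \<in> borel_measurable lebesgue
          \<and> weak_morrey_norm (crit_radius V) \<theta> \<kappa> (maxop (crit_radius V) (real N) f)
              \<le> ennreal C * morrey_norm (crit_radius V) \<theta> \<kappa> f))"
proof (intro allI impI)
  fix \<theta> :: real assume "0 < \<theta> \<and> \<theta> * (N0 + 1) \<le> real N"
  then have "0 < \<theta>" "\<theta> * (N0 + 1) \<le> real N" by simp_all
  moreover have "\<theta> \<le> \<theta> * (N0 + 1)"
    using \<open>0 < \<theta>\<close> \<open>N0 > 0\<close> by simp
  ultimately have \<theta>: "0 < \<theta>" "\<theta> \<le> real N" by linarith+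
  have pos: "crit_radius V u > 0" for u
    using assms(9-11) unfolding hdist_def[symmetric] by (intro slowly_varying_imp_pos) blast+
  have meas: "crit_radius V \<in> borel_measurable lebesgue"
    using assms by (intro borel_measurable_crit_radius) auto
  \<comment> \<open>The constant depends only on the dimension, \<open>\<theta>\<close> and
    \<open>\<kappa>\<close>, hence is fixed before \<open>f\<close>.\<close>
  let ?C = "3 ^ (2 * CARD('n) + 2) * (2 powr \<theta> * (2 ^ (2 * CARD('n) + 2)) powr \<kappa>) + 1 :: real"
  have "?C > 0"
    by (intro add_nonneg_pos) auto
  then show "\<exists>C::real. C > 0 \<and>
        (\<forall>f :: 'n heis \<Rightarrow> real. f \<in> borel_measurable lebesgue
            \<and> morrey_norm (crit_radius V) \<theta> \<kappa> f < \<infinity> \<longrightarrow>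
          maxop (crit_radius V) (real N) f \<in> borel_measurable lebesgue
          \<and> weak_morrey_norm (crit_radius V) \<theta> \<kappa> (maxop (crit_radius V) (real N) f)
              \<le> ennreal C * morrey_norm (crit_radius V) \<theta> \<kappa> f)"
    using assms(1,2) \<theta>
    by (intro exI[of _ ?C] conjI allI impI borel_measurable_maxop maxop_weak_bound pos meas) auto
qed

end
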